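(* The difference scheme $$(\lambda\psi_{j-1}-f_{j-1})-(2\lambda\psi_j+10f_j)+(\lambda\psi_{j+1}-f_{j+1})=0$$ equipped with the discrete boundary conditions (D4TBCs) $$\psi_{-1}-\alpha\psi_0=\alpha^{-1}-\alpha,\qquad \psi_{N_x+1}-\beta\psi_{N_x}=0$$ forms a globally fourth order discretization of the 1D Schrödinger problem $$-\frac{\hbar^2}{2m^*}\psi''(x)+V(x)\psi(x)=E\psi(x),\quad \psi'(0)+\mathrm{i}k_1\psi(0)=2\mathrm{i}k_1,\quad \psi'(L)-\mathrm{i}k_2\psi(L)=0.$$ That is, for $E$ and $V$ fixed and the (smooth) exact solution $\psi$ of the Schrödinger problem, as $\Delta x=L/N_x\to0$: (i) with $F(x)=\frac{2m^*}{\hbar^2}(V(x)-E)\psi(x)$, $$\bigl(\lambda\psi(x_{j-1})-F(x_{j-1})\bigr)-\bigl(2\lambda\psi(x_j)+10F(x_j)\bigr)+\bigl(\lambda\psi(x_{j+1})-F(x_{j+1})\bigr)=O(\Delta x^4)$$ uniformly in $j\in\{0,1,\dots,N_x\}$; (ii) at the two boundaries, $$\psi'(0)+\mathrm{i}k_1\psi(0)-2\mathrm{i}k_1=-\frac{\psi(-\Delta x)-\alpha\psi(0)-\alpha^{-1}+\alpha}{\Delta x}+O(\Delta x^4),$$ $$\psi'(L)-\mathrm{i}k_2\psi(L)=\frac{\psi(L+\Delta x)-\beta\psi(L)}{\Delta x}+O(\Delta x^4).$$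
   Context: Let $L,\hbar,m^*>0$. $V$ is a real potential on $[0,L]$, extended to $\mathbb{R}$ by $V(x)=V(0)$ for $x<0$ and $V(x)=V(L)$ for $x>L$. The energy satisfies $E\ge\max\{V(0),V(L)\}$. Put $k_1=\sqrt{2m^*(E-V(0))/\hbar^2}$ and $k_2=\sqrt{2m^*(E-V(L))/\hbar^2}$. The exact wave function $\psi$ solves the Schrödinger equation on $\mathbb{R}$ and has, outside the device, the form $\psi(x)=r e^{-\mathrm{i}k_1x}+e^{\mathrm{i}k_1x}$ for $x\le0$ and $\psi(x)=\tau e^{\mathrm{i}k_2x}$ for $x\ge L$, for some constants $r,\tau\in\mathbb{C}$ (so it satisfies the two transparent boundary conditions at $0$ and $L$). As usual for order-of-accuracy statements, $V$ and $\psi$ are assumed smooth enough for the Taylor expansions involved. Grid: $\Delta x=L/N_x$, $x_j=j\Delta x$, with two ghost points $x_{-1}=-\Delta x$ and $x_{N_x+1}=L+\Delta x$. $V_j=V(x_j)$, so $V_{-1}=V_0$ and $V_{N_x+1}=V_{N_x}$. In the scheme, $\psi_j$ approximates $\psi(x_j)$, $f_j=\frac{2m^*}{\hbar^2}(V_j-E)\psi_j$, and $\lambda=12/\Delta x^2$; the scheme is imposed for $j=0,1,\dots,N_x$ (interior points and the two boundary points). Let $t=\frac{\hbar^2}{2m^*}\lambda$, assume $t>\max\{2(E-V_0),2(E-V_{N_x})\}$ (true for all small $\Delta x$), and define $$\alpha=\frac{t-5(E-V_0)+\mathrm{i}\sqrt{12(E-V_0)(t-2(E-V_0))}}{t+(E-V_0)},\qquad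 \beta=\frac{t-5(E-V_{N_x})+\mathrm{i}\sqrt{12(E-V_{N_x})(t-2(E-V_{N_x}))}}{t+(E-V_{N_x})}.$$ *)

theory Defs
  imports "HOL-Analysis.Analysis" "HOL-Library.Landau_Symbols" "HOL-Real_Asymp.Real_Asymp"
begin

definition vderiv :: "(real \<Rightarrow> complex) \<Rightarrow> real \<Rightarrow> complex" where
  "vderiv g x = vector_derivative g (at x)"

definition C_k :: "nat \<Rightarrow> (real \<Rightarrow> complex) \<Rightarrow> bool" where
  "C_k k g \<longleftrightarrow>
     (\<forall>i<k. \<forall>x. (vderiv ^^ i) g differentiable (at x)) \<and>
     continuous_on UNIV ((vderiv ^^ k) g)"

text \<open>Only the values of \<open>V\<close> on \<open>[0, L]\<close> matter here.\<close>

definition extend_potential :: "real \<Rightarrow> (real \<Rightarrow> real) \<Rightarrow> real \<Rightarrow> real" where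
  "extend_potential L V x = (if x < 0 then V 0 else if x > L then V L else V x)"

definition schroedinger_solution ::
    "real \<Rightarrow> real \<Rightarrow> (real \<Rightarrow> real) \<Rightarrow> real \<Rightarrow> (real \<Rightarrow> complex) \<Rightarrow> bool" where
  "schroedinger_solution hbar m U E \<psi> \<longleftrightarrow>
     (\<forall>x. \<psi> differentiable (at x) \<and> vderiv \<psi> differentiable (at x) \<and>
          - of_real (hbar\<^sup>2 / (2 * m)) * vderiv (vderiv \<psi>) x + of_real (U x) * \<psi> x
            = of_real E * \<psi> x)"

definition wave_number :: "real \<Rightarrow> real \<Rightarrow> real \<Rightarrow> real \<Rightarrow> real" where
  "wave_number hbar m E v = sqrt (2 * m * (E - v) / hbar\<^sup>2)"

text \<open>
  Grid functions are indexed by \<^typ>\<open>int\<close>, so that the ghost points are the indices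
  \<open>-1\<close> and \<open>N + 1\<close>.
\<close>

definition grid :: "real \<Rightarrow> int \<Rightarrow> real" where
  "grid dx j = of_int j * dx"

definition scheme_f ::
    "real \<Rightarrow> real \<Rightarrow> real \<Rightarrow> (int \<Rightarrow> real) \<Rightarrow> (int \<Rightarrow> complex) \<Rightarrow> int \<Rightarrow> complex" where
  "scheme_f hbar m E v u j = of_real (2 * m / hbar\<^sup>2 * (v j - E)) * u j"

text \<open>
  The difference scheme for a grid function \<open>u\<close> states that \<open>scheme_lhs\<close> vanishes for
  \<open>j = 0, \<dots>, N\<close>; its boundary conditions state that \<open>left_bc\<close> and \<open>right_bc\<close> vanish. Applied to the
  samples of the exact solution, these expressions give the truncation errors.
\<close>

definition scheme_lhs :: "real \<Rightarrow> (int \<Rightarrow> complex) \<Rightarrow> (int \<Rightarrow> complex) \<Rightarrow> int \<Rightarrow> complex" where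
  "scheme_lhs lam u f j =
     (of_real lam * u (j - 1) - f (j - 1)) - (2 * of_real lam * u j + 10 * f j)
       + (of_real lam * u (j + 1) - f (j + 1))"

text \<open>The coefficients \<open>\<alpha>\<close> and \<open>\<beta>\<close> are the cases \<open>e = E - V 0\<close> and \<open>e = E - V L\<close>.\<close>

definition bc_coeff :: "real \<Rightarrow> real \<Rightarrow> complex" where
  "bc_coeff t e =
     (of_real (t - 5 * e) + \<i> * of_real (sqrt (12 * e * (t - 2 * e)))) / of_real (t + e)"

definition left_bc :: "complex \<Rightarrow> (int \<Rightarrow> complex) \<Rightarrow> complex" where
  "left_bc \<alpha> u = u (-1) - \<alpha> * u 0 - (inverse \<alpha> - \<alpha>)"

definition right_bc :: "complex \<Rightarrow> nat \<Rightarrow> (int \<Rightarrow> complex) \<Rightarrow> complex" where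
  "right_bc \<beta> N u = u (int N + 1) - \<beta> * u (int N)"

text \<open>The lower bound imposed on \<open>t\<close> holds automatically on all sufficiently fine grids.\<close>

lemma eventually_t_gt:
  fixes L hbar m c :: real
  assumes "L > 0" "hbar > 0" "m > 0"
  shows "\<forall>\<^sub>F N in sequentially. hbar\<^sup>2 / (2 * m) * (12 / (L / real N)\<^sup>2) > c"
proof -
  have "filterlim (\<lambda>N. hbar\<^sup>2 / (2 * m) * (12 / (L / real N)\<^sup>2)) at_top sequentially"
    using assms by real_asymp
  then show ?thesis
    by (simp add: filterlim_at_top_dense)
qed

end

theory Submission
  imports Defs
begin

text \<open>
  The equation turns \<open>F\<close> into \<open>\<psi>''\<close>, so (i) is the classical estimate for Numerov's scheme: in the
  Taylor expansions of \<open>\<psi>\<close> and \<open>\<psi>''\<close> at \<open>x\<^sub>j\<close> all terms below \<open>\<Delta>x\<^sup>4\<close> cancel. For (ii), the left-hand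
  sides vanish identically, and \<open>\<alpha>\<close> depends only on the phase \<open>w = k\<^sub>1 \<Delta>x\<close>: it has modulus one
  and satisfies \<open>exp (\<i> w) - \<alpha> = O(w\<^sup>5)\<close>. Since \<open>\<alpha>\<inverse>\<close> is the conjugate of \<open>\<alpha>\<close>, the left boundary residual of the
  plane waves is \<open>r (exp (\<i> w) - \<alpha>)\<close> plus the conjugate of \<open>exp (\<i> w) - \<alpha>\<close>; dividing by \<open>\<Delta>x\<close>
  leaves order four. The right boundary is the same with \<open>\<beta>\<close> and no incoming wave.
\<close>

section \<open>Taylor expansion of complex-valued functions of a real variable\<close>

lemma C_k_has_vector_derivative:
  assumes "C_k n g" "i < n"
  shows "((vderiv ^^ i) g has_vector_derivative (vderiv ^^ Suc i) g x) (at x within S)"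
proof -
  have "(vderiv ^^ i) g differentiable (at x)"
    using assms by (simp add: C_k_def)
  then have "((vderiv ^^ i) g has_vector_derivative (vderiv ^^ Suc i) g x) (at x)"
    by (simp add: vderiv_def vector_derivative_works)
  then show ?thesis
    by (rule has_vector_derivative_at_within)
qed

lemma C_k_vderiv2:
  assumes "C_k (Suc (Suc n)) g"
  shows "C_k n (vderiv (vderiv g))"
proof -
  have "(vderiv ^^ i) (vderiv (vderiv g)) = (vderiv ^^ Suc (Suc i)) g" for i
    by (simp add: funpow_swap1)
  then show ?thesis
    using assms unfolding C_k_def by (metis Suc_mono)
qed

text \<open>By compactness the top derivative is bounded on \<open>{a..b}\<close>, so one constant
  serves all expansion points; this is the source of uniformity in the grid index. A complex-valued
  function of a real variable has only a vector derivative, hence \<open>field_Taylor\<close> is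
  applied to real and imaginary parts separately.\<close>

lemma C_k_Taylor_bound:
  assumes g: "C_k (Suc n) g"
  obtains B where "\<And>x y. x \<in> {a..b} \<Longrightarrow> y \<in> {a..b} \<Longrightarrow>
    cmod (g y - (\<Sum>i\<le>n. (vderiv ^^ i) g x * of_real ((y - x) ^ i / fact i))) \<le> B * \<bar>y - x\<bar> ^ Suc n"
proof -
  define D where "D i = (vderiv ^^ i) g" for i
  have "continuous_on {a..b} (D (Suc n))"
    using g continuous_on_subset unfolding C_k_def D_def by blast
  then have "bounded (D (Suc n) ` {a..b})"
    by (intro compact_imp_bounded compact_continuous_image) auto
  then obtain M where M: "\<And>x. x \<in> {a..b} \<Longrightarrow> cmod (D (Suc n) x) \<le> M"
    unfolding bounded_iff by (metis imageI)
  have deriv: "(D i has_vector_derivative D (Suc i) x) (at x within {a..b})" if "i \<le> n" for i x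
    using C_k_has_vector_derivative[OF g] that unfolding D_def by simp
  show ?thesis
  proof (rule that)
    fix x y assume x: "x \<in> {a..b}" and y: "y \<in> {a..b}"
    define R where "R = g y - (\<Sum>i\<le>n. D i x * of_real ((y - x) ^ i / fact i))"
    have "norm (Re (D 0 y) - (\<Sum>i\<le>n. Re (D i x) * (y - x) ^ i / fact i))
            \<le> M * norm (y - x) ^ Suc n / fact n"
    proof (rule field_Taylor[where S = "{a..b}" and f = "\<lambda>i x. Re (D i x)"])
      show "((\<lambda>x. Re (D i x)) has_field_derivative Re (D (Suc i) z)) (at z within {a..b})"
        if "i \<le> n" for i z
        using bounded_linear.has_vector_derivative[OF bounded_linear_Re deriv[OF that]]
        by (simp add: has_real_derivative_iff_has_vector_derivative)
      show "norm (Re (D (Suc n) z)) \<le> M" if "z \<in> {a..b}" for z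
        using M[OF that] abs_Re_le_cmod[of "D (Suc n) z"] by simp
    qed (use x y in auto)
    then have Re: "\<bar>Re R\<bar> \<le> M / fact n * \<bar>y - x\<bar> ^ Suc n"
      by (simp add: R_def D_def del: of_real_power of_real_divide of_real_diff)
    have "norm (Im (D 0 y) - (\<Sum>i\<le>n. Im (D i x) * (y - x) ^ i / fact i))
            \<le> M * norm (y - x) ^ Suc n / fact n"
    proof (rule field_Taylor[where S = "{a..b}" and f = "\<lambda>i x. Im (D i x)"])
      show "((\<lambda>x. Im (D i x)) has_field_derivative Im (D (Suc i) z)) (at z within {a..b})"
        if "i \<le> n" for i z
        using bounded_linear.has_vector_derivative[OF bounded_linear_Im deriv[OF that]]
        by (simp add: has_real_derivative_iff_has_vector_derivative)
      show "norm (Im (D (Suc n) z)) \<le> M" if "z \<in> {a..b}" for z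
        using M[OF that] abs_Im_le_cmod[of "D (Suc n) z"] by simp
    qed (use x y in auto)
    then have Im: "\<bar>Im R\<bar> \<le> M / fact n * \<bar>y - x\<bar> ^ Suc n"
      by (simp add: R_def D_def del: of_real_power of_real_divide of_real_diff)
    \<comment> \<open>The factor 2 is the price of adding the bounds for the two parts.\<close>
    have "cmod R \<le> 2 * (M / fact n) * \<bar>y - x\<bar> ^ Suc n"
      using cmod_le[of R] Re Im by linarith
    then show "cmod (g y - (\<Sum>i\<le>n. (vderiv ^^ i) g x * of_real ((y - x) ^ i / fact i)))
        \<le> 2 * (M / fact n) * \<bar>y - x\<bar> ^ Suc n"
      by (simp add: R_def D_def)
  qed
qed

section \<open>Consistency of Numerov's scheme\<close>

text \<open>The second difference of \<open>g\<close> is h^2 g'' + h^4 g''''/12 up to O(h^6), and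
  the 1-10-1 sum of g'' is 12 g'' + h^2 g'''' up to O(h^4). The factor 12/h^2 makes the main terms
  equal, and it turns the first remainder into O(h^4) as well.\<close>

lemma numerov_truncation_bound:
  assumes g: "C_k 6 g"
  obtains C where "\<And>x h. h > 0 \<Longrightarrow> a \<le> x - h \<Longrightarrow> x + h \<le> b \<Longrightarrow>
    cmod (of_real (12 / h\<^sup>2) * (g (x - h) - 2 * g x + g (x + h))
          - (vderiv (vderiv g) (x - h) + 10 * vderiv (vderiv g) x + vderiv (vderiv g) (x + h)))
      \<le> C * h ^ 4"
proof -
  define D where "D i = (vderiv ^^ i) g" for i
  obtain A where A: "\<And>x y. x \<in> {a..b} \<Longrightarrow> y \<in> {a..b} \<Longrightarrow>
      cmod (g y - (\<Sum>i\<le>5. D i x * of_real ((y - x) ^ i / fact i))) \<le> A * \<bar>y - x\<bar> ^ 6"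
    using C_k_Taylor_bound[of 5 g a b] g unfolding D_def by auto
  have "C_k (Suc 3) (vderiv (vderiv g))"
    using g by (intro C_k_vderiv2) simp
  moreover have "(vderiv ^^ i) (vderiv (vderiv g)) = D (Suc (Suc i))" for i
    by (simp add: D_def funpow_swap1)
  ultimately obtain B where B: "\<And>x y. x \<in> {a..b} \<Longrightarrow> y \<in> {a..b} \<Longrightarrow>
      cmod (D 2 y - (\<Sum>i\<le>3. D (Suc (Suc i)) x * of_real ((y - x) ^ i / fact i))) \<le> B * \<bar>y - x\<bar> ^ 4"
    using C_k_Taylor_bound[of 3 "vderiv (vderiv g)" a b]
    by (auto simp: D_def numeral_2_eq_2)
  show ?thesis
  proof (rule that)
    fix x h :: real assume h: "h > 0" and x: "a \<le> x - h" "x + h \<le> b"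
    \<comment> \<open>\<open>p\<close> and \<open>q\<close> are the Taylor remainders at signed
      offset \<open>s\<close>; in the sums over \<open>h\<close> and \<open>- h\<close> all
      odd-order terms drop out.\<close>
    define p where "p s = g (x + s) - (\<Sum>i\<le>5. D i x * of_real (s ^ i / fact i))" for s
    define q where "q s = D 2 (x + s) - (\<Sum>i\<le>3. D (Suc (Suc i)) x * of_real (s ^ i / fact i))" for s
    have p: "cmod (p h) \<le> A * h ^ 6" "cmod (p (- h)) \<le> A * h ^ 6"
      using A[of x "x + h"] A[of x "x - h"] h x by (auto simp: p_def)
    have q: "cmod (q h) \<le> B * h ^ 4" "cmod (q (- h)) \<le> B * h ^ 4"
      using B[of x "x + h"] B[of x "x - h"] h x by (auto simp: q_def)
    have p_sum: "g (x - h) - 2 * g x + g (x + h)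
        = p h + p (- h) + D 2 x * of_real h ^ 2 + D 4 x * of_real h ^ 4 / 12"
      by (simp add: p_def D_def eval_nat_numeral field_simps)
    have q_sum: "D 2 (x - h) + 10 * D 2 x + D 2 (x + h)
        = q h + q (- h) + 12 * D 2 x + D 4 x * of_real h ^ 2"
      by (simp add: q_def eval_nat_numeral field_simps)
    have split: "of_real (12 / h\<^sup>2) * (g (x - h) - 2 * g x + g (x + h))
          - (D 2 (x - h) + 10 * D 2 x + D 2 (x + h))
        = of_real (12 / h\<^sup>2) * (p h + p (- h)) - (q h + q (- h))"
      unfolding p_sum q_sum using h by (simp add: field_simps eval_nat_numeral)
    have "cmod (of_real (12 / h\<^sup>2) * (p h + p (- h))) \<le> 12 / h\<^sup>2 * (2 * A * h ^ 6)"
      unfolding norm_mult using p h norm_triangle_ineq[of "p h" "p (- h)"]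
      by (intro mult_mono) (auto simp: norm_divide norm_power)
    also have "\<dots> = 24 * A * h ^ 4"
      using h by (simp add: field_simps eval_nat_numeral)
    finally have "cmod (of_real (12 / h\<^sup>2) * (p h + p (- h)) - (q h + q (- h)))
        \<le> (24 * A + 2 * B) * h ^ 4"
      using norm_triangle_ineq4[of "of_real (12 / h\<^sup>2) * (p h + p (- h))" "q h + q (- h)"]
        norm_triangle_ineq[of "q h" "q (- h)"] q by (simp add: algebra_simps)
    then show "cmod (of_real (12 / h\<^sup>2) * (g (x - h) - 2 * g x + g (x + h))
          - (vderiv (vderiv g) (x - h) + 10 * vderiv (vderiv g) x + vderiv (vderiv g) (x + h)))
        \<le> (24 * A + 2 * B) * h ^ 4"
      unfolding split[symmetric] by (simp add: D_def numeral_2_eq_2)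
  qed
qed

section \<open>The coefficient of the discrete boundary conditions\<close>

text \<open>Numerator and denominator are both homogeneous of degree one for positive factors, so
  only the ratio of the arguments matters and \<open>t\<close> may be normalised to 12.\<close>

lemma bc_coeff_mult:
  assumes "c > 0"
  shows "bc_coeff (c * t) (c * e) = bc_coeff t e"
proof -
  have "12 * (c * e) * (c * t - 2 * (c * e)) = c\<^sup>2 * (12 * e * (t - 2 * e))"
    by (simp add: power2_eq_square algebra_simps)
  then have "sqrt (12 * (c * e) * (c * t - 2 * (c * e))) = c * sqrt (12 * e * (t - 2 * e))"
    using assms by (simp only: real_sqrt_mult real_sqrt_abs abs_of_pos)
  then have "bc_coeff (c * t) (c * e) =
      of_real c * (of_real (t - 5 * e) + \<i> * of_real (sqrt (12 * e * (t - 2 * e)))) / (of_real c * of_real (t + e))"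
    unfolding bc_coeff_def by (simp add: algebra_simps)
  then show ?thesis
    using assms by (simp add: bc_coeff_def)
qed

text \<open>For constant potential the scheme has the characteristic equation (t + e)(z + 1/z) = 2(t
  - 5e); \<open>bc_coeff\<close> is its root with nonnegative imaginary part. The bound
  \<open>t \<ge> 2 * e\<close> keeps the radicand nonnegative, which puts the root on the unit
  circle.\<close>

lemma cmod_bc_coeff:
  assumes "e \<ge> 0" "t \<ge> 2 * e" "t > 0"
  shows "cmod (bc_coeff t e) = 1"
proof -
  have "(t - 5 * e)\<^sup>2 + 12 * e * (t - 2 * e) = (t + e)\<^sup>2"
    by (simp add: power2_eq_square algebra_simps)
  then have "cmod (of_real (t - 5 * e) + \<i> * of_real (sqrt (12 * e * (t - 2 * e)))) = t + e"
    using assms by (simp add: cmod_def)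
  then show ?thesis
    using assms by (simp add: bc_coeff_def norm_divide del: of_real_add)
qed

text \<open>Reduces a complex estimate to two real ones, which \<open>real_asymp\<close> can
  settle.\<close>

lemma bigo_Complex:
  assumes "(\<lambda>x. Re (f x)) \<in> O[F](g)" "(\<lambda>x. Im (f x)) \<in> O[F](g)"
  shows "f \<in> O[F](\<lambda>x. complex_of_real (g x))"
proof -
  have "(\<lambda>x. \<bar>Re (f x)\<bar> + \<bar>Im (f x)\<bar>) \<in> O[F](g)"
    using assms by (intro sum_in_bigo) simp_all
  moreover have "(\<lambda>x. cmod (f x)) \<in> O[F](\<lambda>x. \<bar>Re (f x)\<bar> + \<bar>Im (f x)\<bar>)"
    by (intro landau_o.bigI[of 1] always_eventually) (auto intro: cmod_le)
  ultimately have "(\<lambda>x. cmod (f x)) \<in> O[F](g)"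
    by (rule landau_o.big_trans[rotated])
  then show ?thesis
    by (simp add: bigo_def)
qed

text \<open>The real parts agree up to O(w^6), while the imaginary parts differ by -w^5/480 to
  leading order, so 5 is the exact order. The filter is one-sided because the square root behaves
  like the absolute value of \<open>w\<close>, not like \<open>w\<close>.\<close>

lemma exp_minus_bc_coeff_bigo:
  "(\<lambda>w. exp (\<i> * of_real w) - bc_coeff 12 (w\<^sup>2)) \<in> O[at_right 0](\<lambda>w. of_real (w ^ 5))"
proof (rule bigo_Complex)
  have "(\<lambda>w::real. cos w - (12 - 5 * w\<^sup>2) / (12 + w\<^sup>2)) \<in> O[at_right 0](\<lambda>w. w ^ 5)"
    by real_asymp
  then show "(\<lambda>w. Re (exp (\<i> * of_real w) - bc_coeff 12 (w\<^sup>2))) \<in> O[at_right 0](\<lambda>w. w ^ 5)"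
    by (simp add: bc_coeff_def Re_exp Re_divide_of_real del: of_real_add of_real_power)
  have "(\<lambda>w::real. sin w - sqrt (12 * w\<^sup>2 * (12 - 2 * w\<^sup>2)) / (12 + w\<^sup>2)) \<in> O[at_right 0](\<lambda>w. w ^ 5)"
    by real_asymp
  then show "(\<lambda>w. Im (exp (\<i> * of_real w) - bc_coeff 12 (w\<^sup>2))) \<in> O[at_right 0](\<lambda>w. w ^ 5)"
    by (simp add: bc_coeff_def Im_exp Im_divide_of_real del: of_real_add of_real_power)
qed

lemma exp_minus_bc_coeff_grid_bigo:
  fixes L k :: real
  assumes "L > 0" "k \<ge> 0"
  shows "(\<lambda>N. exp (\<i> * of_real (k * (L / real N))) - bc_coeff 12 ((k * (L / real N))\<^sup>2))
    \<in> O(\<lambda>N. of_real ((L / real N) ^ 5))"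
proof (cases "k = 0")
  \<comment> \<open>For \<open>k = 0\<close> the phase is constantly 0 and does not tend to
    \<open>at_right 0\<close>; but then the exponential and the coefficient are both 1.\<close>
  case True
  then show ?thesis by (simp add: bc_coeff_def)
next
  case False
  then have "k > 0" using assms by simp
  then have "filterlim (\<lambda>N. k * (L / real N)) (at_right 0) sequentially"
    using \<open>L > 0\<close> by real_asymp
  note landau_o.big.compose[OF exp_minus_bc_coeff_bigo this]
  moreover have "(\<lambda>N. complex_of_real ((k * (L / real N)) ^ 5)) \<in> O(\<lambda>N. of_real ((L / real N) ^ 5))"
    using \<open>k > 0\<close> \<open>L > 0\<close>
    by (intro landau_o.bigI[of "k ^ 5"] always_eventually)
      (simp_all add: norm_mult norm_divide norm_power power_mult_distrib power_divide)
  ultimately show ?thesis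
    by (rule landau_o.big_trans)
qed

lemma exp_minus_bc_coeff_wave_number_bigo:
  fixes L hbar m E v :: real
  assumes "L > 0" "hbar > 0" "m > 0" "E \<ge> v"
  shows "(\<lambda>N. exp (\<i> * of_real (wave_number hbar m E v * (L / real N)))
            - bc_coeff (hbar\<^sup>2 / (2 * m) * (12 / (L / real N)\<^sup>2)) (E - v))
    \<in> O(\<lambda>N. of_real ((L / real N) ^ 5))"
proof -
  define k where "k = wave_number hbar m E v"
  have k: "k \<ge> 0" "k\<^sup>2 = 2 * m * (E - v) / hbar\<^sup>2"
    using assms by (simp_all add: k_def wave_number_def)
  have "bc_coeff 12 ((k * (L / real N))\<^sup>2) = bc_coeff (hbar\<^sup>2 / (2 * m) * (12 / (L / real N)\<^sup>2)) (E - v)"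
    if "N > 0" for N
  proof -
    \<comment> \<open>This factor carries the normalised pair of 12 and squared phase to the pair of
      \<open>t\<close> and \<open>E - v\<close>.\<close>
    define c where "c = hbar\<^sup>2 / (2 * m * (L / real N)\<^sup>2)"
    have "c > 0"
      using assms that by (simp add: c_def)
    moreover have "c * 12 = hbar\<^sup>2 / (2 * m) * (12 / (L / real N)\<^sup>2)"
      by (simp add: c_def)
    moreover have "c * (k * (L / real N))\<^sup>2 = E - v"
      unfolding power_mult_distrib k(2) c_def using assms that by (simp add: field_simps)
    ultimately show ?thesis
      using bc_coeff_mult[of c 12 "(k * (L / real N))\<^sup>2"] by simp
  qed
  then have "\<forall>\<^sub>F N in sequentially.
      exp (\<i> * of_real (k * (L / real N))) - bc_coeff 12 ((k * (L / real N))\<^sup>2)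
      = exp (\<i> * of_real (k * (L / real N)))
        - bc_coeff (hbar\<^sup>2 / (2 * m) * (12 / (L / real N)\<^sup>2)) (E - v)"
    by (intro eventually_mono[OF eventually_gt_at_top[of 0]]) simp
  from landau_o.big.in_cong[OF this] exp_minus_bc_coeff_grid_bigo[OF assms(1) k(1)]
  show ?thesis
    unfolding k_def by blast
qed

section \<open>Derivatives of plane waves at the device boundary, and division by the mesh
  width\<close>

lemma has_vector_derivative_exp:
  "((\<lambda>x. exp (c * of_real (k * x))) has_vector_derivative c * of_real k * exp (c * of_real (k * x)))
    (at x within S)" for c :: complex
proof -
  have "((\<lambda>z. exp (c * of_real k * z)) has_field_derivative c * of_real k * exp (c * of_real k * of_real x))
      (at (of_real x))"
    by (auto intro!: derivative_eq_intros)
  from has_vector_derivative_real_field[OF this] show ?thesis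
    by (simp add: mult.assoc)
qed

text \<open>The plane-wave form of the solution is known on one side of each boundary only. Since
  the two-sided derivative exists, the one-sided one on a nondegenerate interval determines
  it.\<close>

lemma vderiv_eqI:
  assumes "a < b" "x \<in> {a..b}" "g differentiable (at x)"
    and eq: "\<And>y. y \<in> {a..b} \<Longrightarrow> g y = f y"
    and f: "(f has_vector_derivative d) (at x within {a..b})"
  shows "vderiv g x = d"
proof -
  have "(g has_vector_derivative vderiv g x) (at x within {a..b})"
    using vector_derivative_works[THEN iffD1, OF assms(3)] unfolding vderiv_def
    by (rule has_vector_derivative_at_within)
  moreover have "(g has_vector_derivative d) (at x within {a..b})"
    using assms(2) by (intro has_vector_derivative_transform[OF _ _ f]) (auto simp: eq)
  ultimately show ?thesis
    using vector_derivative_unique_within_closed_interval[of a b x g] assms(1,2) by simp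
qed

text \<open>The mesh width \<open>L / real N\<close> is 0 at \<open>N = 0\<close>; where
  \<open>d N = 0\<close> the quotient is 0 by convention, so the bound persists without a positivity
  assumption.\<close>

lemma bigo_divide_of_real:
  fixes d :: "nat \<Rightarrow> real"
  assumes "f \<in> O(\<lambda>N. complex_of_real (d N ^ Suc n))"
  shows "(\<lambda>N. f N / of_real (d N)) \<in> O(\<lambda>N. complex_of_real (d N ^ n))"
proof -
  from assms obtain c where c: "c > 0"
    "\<forall>\<^sub>F N in sequentially. norm (f N) \<le> c * norm (complex_of_real (d N ^ Suc n))"
    by (elim landau_o.bigE)
  show ?thesis
  proof (rule landau_o.bigI[OF c(1)], rule eventually_mono[OF c(2)])
    fix N assume "norm (f N) \<le> c * norm (complex_of_real (d N ^ Suc n))"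
    then show "norm (f N / of_real (d N)) \<le> c * norm (complex_of_real (d N ^ n))"
      using c(1) by (cases "d N = 0")
        (simp_all add: norm_divide norm_mult norm_power field_simps)
  qed
qed

section \<open>Truncation errors in the interior and at both boundaries\<close>

theorem theorem1:
  fixes L hbar m E k1 k2 :: real
    and V U :: "real \<Rightarrow> real"
    and \<psi> :: "real \<Rightarrow> complex"
    and r \<tau> :: complex
    and dx lam t :: "nat \<Rightarrow> real"
    and \<alpha> \<beta> :: "nat \<Rightarrow> complex"
    and \<psi>s fs :: "nat \<Rightarrow> int \<Rightarrow> complex"
  assumes "L > 0" and "hbar > 0" and "m > 0"
    and U: "U = extend_potential L V"
    and E: "E \<ge> max (V 0) (V L)"
    and k1: "k1 = wave_number hbar m E (V 0)"
    and k2: "k2 = wave_number hbar m E (V L)"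
    and sol: "schroedinger_solution hbar m U E \<psi>"
    and left: "\<forall>x\<le>0. \<psi> x = r * exp (- \<i> * of_real (k1 * x)) + exp (\<i> * of_real (k1 * x))"
    and right: "\<forall>x\<ge>L. \<psi> x = \<tau> * exp (\<i> * of_real (k2 * x))"
    and smooth: "C_k 6 \<psi>"
    and dx: "\<forall>N. dx N = L / real N"
    and lam: "\<forall>N. lam N = 12 / (dx N)\<^sup>2"
    and t: "\<forall>N. t N = hbar\<^sup>2 / (2 * m) * lam N"
    and t_large: "\<forall>\<^sub>F N in sequentially. t N > max (2 * (E - V 0)) (2 * (E - V L))"
    and \<alpha>: "\<forall>N. \<alpha> N = bc_coeff (t N) (E - V 0)"
    and \<beta>: "\<forall>N. \<beta> N = bc_coeff (t N) (E - V L)"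
    and \<psi>s: "\<forall>N j. \<psi>s N j = \<psi> (grid (dx N) j)"
    and fs: "\<forall>N. fs N = scheme_f hbar m E (\<lambda>j. U (grid (dx N) j)) (\<psi>s N)"
  shows "(\<lambda>N. MAX j\<in>{0..int N}. cmod (scheme_lhs (lam N) (\<psi>s N) (fs N) j))
           \<in> O(\<lambda>N. dx N ^ 4)
    \<and> (\<lambda>N. (vderiv \<psi> 0 + \<i> * of_real k1 * \<psi> 0 - 2 * \<i> * of_real k1)
              - (- (left_bc (\<alpha> N) (\<psi>s N) / of_real (dx N))))
           \<in> O(\<lambda>N. complex_of_real (dx N ^ 4))
    \<and> (\<lambda>N. (vderiv \<psi> L - \<i> * of_real k2 * \<psi> L)
              - right_bc (\<beta> N) N (\<psi>s N) / of_real (dx N))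
           \<in> O(\<lambda>N. complex_of_real (dx N ^ 4))"
proof (intro conjI)
  have diff: "\<psi> differentiable (at x)" for x
    using sol by (simp add: schroedinger_solution_def)
  \<comment> \<open>The equation holds on the whole line with the extended potential, so this covers
    the ghost points too.\<close>
  have F: "of_real (2 * m / hbar\<^sup>2 * (U x - E)) * \<psi> x = vderiv (vderiv \<psi>) x" for x
  proof -
    have "of_real (hbar\<^sup>2 / (2 * m)) * vderiv (vderiv \<psi>) x = of_real (U x - E) * \<psi> x"
      using sol unfolding schroedinger_solution_def by (auto simp: algebra_simps)
    then have "of_real (2 * m / hbar\<^sup>2) * (of_real (hbar\<^sup>2 / (2 * m)) * vderiv (vderiv \<psi>) x)
        = of_real (2 * m / hbar\<^sup>2) * (of_real (U x - E) * \<psi> x)"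
      by (rule arg_cong)
    moreover have "complex_of_real (2 * m / hbar\<^sup>2) * of_real (hbar\<^sup>2 / (2 * m)) = 1"
      unfolding of_real_mult[symmetric] using \<open>hbar > 0\<close> \<open>m > 0\<close> by simp
    ultimately show ?thesis
      by (simp only: of_real_mult mult.assoc[symmetric] mult_1)
  qed
  \<comment> \<open>The interval from \<open>- L\<close> to \<open>2 * L\<close> contains every grid
    with its ghost points, since \<open>dx N \<le> L\<close> once \<open>N > 0\<close>. Thus
    \<open>C\<close> depends on neither \<open>N\<close> nor \<open>j\<close>.\<close>
  obtain C where C: "\<And>x h. h > 0 \<Longrightarrow> - L \<le> x - h \<Longrightarrow> x + h \<le> 2 * L \<Longrightarrow>
      cmod (of_real (12 / h\<^sup>2) * (\<psi> (x - h) - 2 * \<psi> x + \<psi> (x + h))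
          - (vderiv (vderiv \<psi>) (x - h) + 10 * vderiv (vderiv \<psi>) x + vderiv (vderiv \<psi>) (x + h)))
        \<le> C * h ^ 4"
    using numerov_truncation_bound[OF smooth, of "- L" "2 * L"] by metis
  have scheme: "cmod (scheme_lhs (lam N) (\<psi>s N) (fs N) j) \<le> C * dx N ^ 4"
    if "N > 0" "j \<in> {0..int N}" for N j
  proof -
    define h x where "h = dx N" and "x = grid (dx N) j"
    have h: "0 < h" "h \<le> L"
      using that \<open>L > 0\<close> dx by (auto simp: h_def field_simps)
    have x: "0 \<le> x" "x \<le> L"
    proof -
      have "real_of_int j \<le> real N"
        using that(2) by auto
      then show "0 \<le> x" "x \<le> L"
        using that \<open>L > 0\<close> dx by (auto simp: x_def grid_def field_simps)
    qed
    have nb: "grid h (j - 1) = x - h" "grid h (j + 1) = x + h" "grid h j = x"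
      by (simp_all add: grid_def x_def h_def algebra_simps)
    have "scheme_lhs (lam N) (\<psi>s N) (fs N) j =
        of_real (12 / h\<^sup>2) * (\<psi> (x - h) - 2 * \<psi> x + \<psi> (x + h))
          - (vderiv (vderiv \<psi>) (x - h) + 10 * vderiv (vderiv \<psi>) x + vderiv (vderiv \<psi>) (x + h))"
      unfolding scheme_lhs_def fs[rule_format] scheme_f_def \<psi>s[rule_format] F
        h_def[symmetric] nb lam[rule_format]
      by (simp only: algebra_simps)
    then show ?thesis
      using C[of h x] h x by (simp add: h_def)
  qed
  show "(\<lambda>N. MAX j\<in>{0..int N}. cmod (scheme_lhs (lam N) (\<psi>s N) (fs N) j)) \<in> O(\<lambda>N. dx N ^ 4)"
  proof (rule bigoI, rule eventually_mono[OF eventually_gt_at_top[of 0]])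
    fix N :: nat assume "N > 0"
    let ?e = "\<lambda>j. cmod (scheme_lhs (lam N) (\<psi>s N) (fs N) j)"
    have "Max (?e ` {0..int N}) \<in> ?e ` {0..int N}"
      by (rule Max_in) auto
    then obtain j where "j \<in> {0..int N}" "Max (?e ` {0..int N}) = ?e j"
      by blast
    then show "norm (MAX j\<in>{0..int N}. ?e j) \<le> C * norm (dx N ^ 4)"
      using scheme[OF \<open>N > 0\<close>] by simp
  qed
  have bc0: "vderiv \<psi> 0 + \<i> * of_real k1 * \<psi> 0 - 2 * \<i> * of_real k1 = 0"
  proof -
    have "((\<lambda>x. r * exp (- \<i> * of_real (k1 * x)) + exp (\<i> * of_real (k1 * x)))
        has_vector_derivative (- \<i> * k1 * r + \<i> * k1)) (at 0 within {-1..0})"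
      by (rule has_vector_derivative_eq_rhs, rule has_vector_derivative_add,
          rule has_vector_derivative_mult_right, (rule has_vector_derivative_exp)+) simp
    from vderiv_eqI[OF _ _ diff _ this] left
    have "vderiv \<psi> 0 = - \<i> * k1 * r + \<i> * k1" by simp
    then show ?thesis
      using left by (simp add: algebra_simps)
  qed
  have bcL: "vderiv \<psi> L - \<i> * of_real k2 * \<psi> L = 0"
  proof -
    have "((\<lambda>x. \<tau> * exp (\<i> * of_real (k2 * x))) has_vector_derivative
        (\<i> * k2 * (\<tau> * exp (\<i> * of_real (k2 * L))))) (at L within {L..L+1})"
      by (rule has_vector_derivative_eq_rhs, rule has_vector_derivative_mult_right,
          rule has_vector_derivative_exp) simp
    from vderiv_eqI[OF _ _ diff _ this] right show ?thesis by simp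
  qed
  have \<alpha>_bigo: "(\<lambda>N. exp (\<i> * of_real (k1 * dx N)) - \<alpha> N) \<in> O(\<lambda>N. of_real (dx N ^ 5))"
    using exp_minus_bc_coeff_wave_number_bigo[of L hbar m "V 0" E] assms(1-3) E
    by (simp only: \<alpha> t lam dx k1 max.bounded_iff)
  have \<beta>_bigo: "(\<lambda>N. exp (\<i> * of_real (k2 * dx N)) - \<beta> N) \<in> O(\<lambda>N. of_real (dx N ^ 5))"
    using exp_minus_bc_coeff_wave_number_bigo[of L hbar m "V L" E] assms(1-3) E
    by (simp only: \<beta> t lam dx k2 max.bounded_iff)
  have "(\<lambda>N. left_bc (\<alpha> N) (\<psi>s N)) \<in> O(\<lambda>N. of_real (dx N ^ 5))"
  proof -
    let ?e = "\<lambda>N. exp (\<i> * of_real (k1 * dx N)) - \<alpha> N"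
    \<comment> \<open>Here \<psi>(0) = r + 1, and the 1 from the incoming wave cancels the last
      \<alpha> of the boundary condition.\<close>
    have "\<forall>\<^sub>F N in sequentially. r * ?e N + cnj (?e N) = left_bc (\<alpha> N) (\<psi>s N)"
      using t_large
    proof eventually_elim
      case (elim N)
      \<comment> \<open>As \<open>E \<ge> V 0\<close>, the lower bound on \<open>t N\<close> yields
        both positivity and the nonnegative radicand.\<close>
      then have "cmod (\<alpha> N) = 1"
        using E unfolding \<alpha>[rule_format] by (intro cmod_bc_coeff) auto
      then have "\<alpha> N * cnj (\<alpha> N) = 1"
        using complex_norm_square[of "\<alpha> N"] by simp
      then have "inverse (\<alpha> N) = cnj (\<alpha> N)"
        by (rule inverse_unique)
      moreover have "dx N \<ge> 0"
        using dx \<open>L > 0\<close> by simp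
      ultimately show ?case
        using left by (simp add: left_bc_def \<psi>s grid_def exp_cnj algebra_simps)
    qed
    moreover have "(\<lambda>N. r * ?e N + cnj (?e N)) \<in> O(\<lambda>N. of_real (dx N ^ 5))"
    proof (rule sum_in_bigo)
      show "(\<lambda>N. r * ?e N) \<in> O(\<lambda>N. of_real (dx N ^ 5))"
        \<comment> \<open>A constant factor can be cancelled inside a Landau symbol only if it is
          nonzero; hence the case split.\<close>
        using \<alpha>_bigo by (cases "r = 0") auto
      show "(\<lambda>N. cnj (?e N)) \<in> O(\<lambda>N. of_real (dx N ^ 5))"
        using \<alpha>_bigo by (simp only: bigo_def complex_mod_cnj mem_Collect_eq)
    qed
    ultimately show ?thesis
      by (rule iffD1[OF landau_o.big.in_cong])
  qed
  then have "(\<lambda>N. left_bc (\<alpha> N) (\<psi>s N) / of_real (dx N)) \<in> O(\<lambda>N. of_real (dx N ^ 4))"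
    by (intro bigo_divide_of_real) simp
  then show "(\<lambda>N. (vderiv \<psi> 0 + \<i> * of_real k1 * \<psi> 0 - 2 * \<i> * of_real k1)
              - (- (left_bc (\<alpha> N) (\<psi>s N) / of_real (dx N))))
           \<in> O(\<lambda>N. complex_of_real (dx N ^ 4))"
    unfolding bc0 by simp
  have "(\<lambda>N. right_bc (\<beta> N) N (\<psi>s N)) \<in> O(\<lambda>N. of_real (dx N ^ 5))"
  proof -
    let ?e = "\<lambda>N. exp (\<i> * of_real (k2 * dx N)) - \<beta> N"
    \<comment> \<open>The outgoing wave gains the factor exp(i k2 dx) over one mesh width, so its
      value at \<open>L\<close> factors out. For \<open>N = 0\<close> the last grid point would be 0
      instead of \<open>L\<close>.\<close>
    have "\<forall>\<^sub>F N in sequentially. \<tau> * exp (\<i> * of_real (k2 * L)) * ?e N = right_bc (\<beta> N) N (\<psi>s N)"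
      using eventually_gt_at_top[of 0]
    proof eventually_elim
      case (elim N)
      have "grid (dx N) (int N) = L" "grid (dx N) (int N + 1) = L + dx N" "dx N \<ge> 0"
        using dx \<open>L > 0\<close> elim by (auto simp: grid_def field_simps)
      then show ?case
        using right by (simp add: right_bc_def \<psi>s ring_distribs exp_add mult_ac)
    qed
    moreover have "(\<lambda>N. \<tau> * exp (\<i> * of_real (k2 * L)) * ?e N) \<in> O(\<lambda>N. of_real (dx N ^ 5))"
      using \<beta>_bigo by (cases "\<tau> = 0") auto
    ultimately show ?thesis
      by (rule iffD1[OF landau_o.big.in_cong])
  qed
  then have "(\<lambda>N. right_bc (\<beta> N) N (\<psi>s N) / of_real (dx N)) \<in> O(\<lambda>N. of_real (dx N ^ 4))"
    by (intro bigo_divide_of_real) simp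
  then show "(\<lambda>N. (vderiv \<psi> L - \<i> * of_real k2 * \<psi> L) - right_bc (\<beta> N) N (\<psi>s N) / of_real (dx N))
           \<in> O(\<lambda>N. complex_of_real (dx N ^ 4))"
    unfolding bcL by simp
qed

end
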